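(* Fix a positive integer $n$, a real number $p\in [0,1]$, and two hypergraphs $\mathcal{H}_1,\mathcal{H}_2$ on $[n]$. If $\mathcal{H}_1 \subset\mathcal{H}_2$ then, for every monotone increasing (multi)graph property $\mathcal{P}$, \[ \mathbb{P}(\mathbb{G}(n,p\, ; \, \mathcal{H}_1) \in \mathcal{P}) \le \mathbb{P}(\mathbb{G}(n,p\, ; \, \mathcal{H}_2) \in \mathcal{P}) . \]
   Context: A hypergraph on $[n]=\{1,\dots,n\}$ is a finite collection (multiset) of subsets of $[n]$, each of size at least 2, with repetitions allowed; $\mathcal{H}_1\subset\mathcal{H}_2$ means inclusion as collections (each set occurs in $\mathcal{H}_1$ at most as many times as in $\mathcal{H}_2$). For $p\in[0,1]$ and a hypergraph $\mathcal{H}$ on $[n]$, the random multigraph $\mathbb{G}(n,p\,;\,\mathcal{H})$ is generated as follows: start with the empty graph on vertex set $[n]$; for every member $H\in\mathcal{H}$ (each occurrence separately), choose a 2-element subset $\{i,j\}\subset H$ uniformly at random and then add an edge between $i$ and $j$ with probability $p$; all choices and coin flips are mutually independent. A multigraph property is monotone increasing if it is preserved under adding edges. *)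

theory Defs
  imports "HOL-Probability.Probability"
begin

type_synonym hypergraph = "nat set multiset"

definition hypergraph_on :: "nat \<Rightarrow> hypergraph \<Rightarrow> bool" where
  "hypergraph_on n \<H> \<longleftrightarrow> (\<forall>H \<in># \<H>. H \<subseteq> {1..n} \<and> card H \<ge> 2)"

text \<open>A multigraph is a pair of a vertex set and a multiset of edges (no loops).\<close>

type_synonym multigraph = "nat set \<times> nat set multiset"

definition pairs :: "nat set \<Rightarrow> nat set set" where
  "pairs V = {e. e \<subseteq> V \<and> card e = 2}"

definition is_multigraph :: "multigraph \<Rightarrow> bool" where
  "is_multigraph G \<longleftrightarrow> finite (fst G) \<and> set_mset (snd G) \<subseteq> pairs (fst G)"

text \<open>A property need not be invariant under isomorphism; its behaviour on pairs
  that are not multigraphs is irrelevant.\<close>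

definition monotone_increasing :: "multigraph set \<Rightarrow> bool" where
  "monotone_increasing \<P> \<longleftrightarrow>
     (\<forall>V E e. is_multigraph (V, E) \<and> (V, E) \<in> \<P> \<and> e \<in> pairs V \<longrightarrow> (V, add_mset e E) \<in> \<P>)"

text \<open>The contribution of one occurrence of \<open>H\<close>: at most one edge.\<close>

definition edge_pmf :: "real \<Rightarrow> nat set \<Rightarrow> nat set multiset pmf" where
  "edge_pmf p H = do {
     e \<leftarrow> pmf_of_set (pairs H);
     b \<leftarrow> bernoulli_pmf p;
     return_pmf (if b then {#e#} else {#})
   }"

text \<open>Repeated members of \<open>\<H>\<close> are told apart by an index, so that the product measure
  below has one independent factor for each occurrence.\<close>

definition occurrences :: "hypergraph \<Rightarrow> (nat set \<times> nat) set" where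
  "occurrences \<H> = (SIGMA H:set_mset \<H>. {..<count \<H> H})"

definition random_multigraph :: "nat \<Rightarrow> real \<Rightarrow> hypergraph \<Rightarrow> multigraph pmf" where
  "random_multigraph n p \<H> =
     map_pmf (\<lambda>f. ({1..n}, \<Sum>x\<in>occurrences \<H>. f x))
       (Pi_pmf (occurrences \<H>) {#} (\<lambda>(H, k). edge_pmf p H))"

end

theory Submission
  imports Defs
begin

text \<open>Coupling: restricting the independent choices for \<open>\<H>2\<close> to the occurrences in \<open>\<H>1\<close>
  gives a copy of the random multigraph of \<open>\<H>1\<close> inside that of \<open>\<H>2\<close>.\<close>

lemma finite_pairs:
  assumes "finite V"
  shows "finite (pairs V)"
  using assms unfolding pairs_def by (auto intro: finite_subset[of _ "Pow V"])

lemma pairs_mono: "U \<subseteq> V \<Longrightarrow> pairs U \<subseteq> pairs V"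
  unfolding pairs_def by auto

lemma pairs_nonempty:
  assumes "card V \<ge> 2"
  shows "pairs V \<noteq> {}"
  using obtain_subset_with_card_n[OF assms] unfolding pairs_def by blast

lemma finite_occurrences: "finite (occurrences \<H>)"
  unfolding occurrences_def by auto

text \<open>The indices of the copies of a set form an initial segment of the naturals, so a smaller
  multiplicity gives a subset of the same labels.\<close>

lemma occurrences_mono:
  assumes "\<H>1 \<subseteq># \<H>2"
  shows "occurrences \<H>1 \<subseteq> occurrences \<H>2"
  using assms mset_subset_eqD[OF assms] mset_subset_eq_count[OF assms]
  unfolding occurrences_def by (fastforce intro: less_le_trans)

text \<open>Monotonicity speaks of one edge added to a genuine multigraph, so the edges of
  \<open>F\<close> go in one at a time and each intermediate pair is again a multigraph.\<close>

lemma monotone_increasing_union: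
  assumes "monotone_increasing \<P>" and "is_multigraph (V, E)" and "(V, E) \<in> \<P>"
    and "set_mset F \<subseteq> pairs V"
  shows "(V, E + F) \<in> \<P>"
  using assms(4)
proof (induction F)
  case empty
  then show ?case using assms(3) by simp
next
  case (add e F)
  then have "is_multigraph (V, E + F)"
    using assms(2) by (auto simp: is_multigraph_def)
  then show ?case
    using add assms(1) by (auto simp: monotone_increasing_def)
qed

text \<open>\<open>pmf_of_set\<close> has the expected support only on a finite nonempty set;
  \<open>card H \<ge> 2\<close> supplies a pair to choose.\<close>

lemma set_mset_edge_pmf:
  assumes "E \<in> set_pmf (edge_pmf p H)" and "finite H" and "card H \<ge> 2"
  shows "set_mset E \<subseteq> pairs H"
  using assms finite_pairs[OF assms(2)] pairs_nonempty[OF assms(3)]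
  by (auto simp: edge_pmf_def set_pmf_of_set split: if_splits)

theorem theorem1p6:
  fixes n :: nat and p :: real and \<H>1 \<H>2 :: hypergraph
  assumes "n > 0" and "p \<in> {0..1}"
    and "hypergraph_on n \<H>1" and "hypergraph_on n \<H>2"
    and "\<H>1 \<subseteq># \<H>2"
  shows "\<forall>\<P>. monotone_increasing \<P> \<longrightarrow>
           measure_pmf.prob (random_multigraph n p \<H>1) \<P>
             \<le> measure_pmf.prob (random_multigraph n p \<H>2) \<P>"
proof (intro allI impI)
  fix \<P> assume \<P>: "monotone_increasing \<P>"
  let ?V = "{1..n}" and ?A = "occurrences \<H>1" and ?B = "occurrences \<H>2"
  define M where "M = Pi_pmf ?B {#} (\<lambda>(H, k). edge_pmf p H)"
  define G where "G S f = (?V, \<Sum>x\<in>S. f x)" for S :: "(nat set \<times> nat) set" and f :: "_ \<Rightarrow> nat set multiset"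
  have AB: "?A \<subseteq> ?B"
    using occurrences_mono assms(5) .
  \<comment> \<open>The marginal of a product on a subset of its coordinates is the product over
    that subset. Resetting \<open>f\<close> to \<open>{#}\<close> outside \<open>?A\<close> does not
    change the sum over \<open>?A\<close>.\<close>
  have "random_multigraph n p \<H>1 = map_pmf (G ?A) M"
    unfolding random_multigraph_def M_def Pi_pmf_subset[OF finite_occurrences AB]
    by (simp add: map_pmf_comp G_def[abs_def])
  moreover have "random_multigraph n p \<H>2 = map_pmf (G ?B) M"
    unfolding random_multigraph_def M_def G_def ..
  moreover have "measure_pmf.prob M (G ?A -` \<P>) \<le> measure_pmf.prob M (G ?B -` \<P>)"
  \<comment> \<open>The inclusion of events is claimed only on the support of \<open>M\<close>:
    elsewhere \<open>f\<close> may take values that are not edges on \<open>?V\<close>, where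
    monotonicity says nothing.\<close>
  proof (rule measure_pmf.finite_measure_mono_AE)
    have "G ?B f \<in> \<P>" if f: "f \<in> set_pmf M" and in_P: "G ?A f \<in> \<P>" for f
    proof -
      have "set_mset (f x) \<subseteq> pairs ?V" if "x \<in> ?B" for x
      proof -
        obtain H k where x: "x = (H, k)" by fastforce
        with that have H: "H \<subseteq> ?V" "card H \<ge> 2"
          using assms(4) by (auto simp: occurrences_def hypergraph_on_def)
        have "f x \<in> set_pmf (edge_pmf p H)"
          using f that unfolding M_def
          by (simp add: set_Pi_pmf finite_occurrences PiE_dflt_def x)
        then have "set_mset (f x) \<subseteq> pairs H"
          using set_mset_edge_pmf finite_subset[OF H(1)] H(2) by blast
        then show ?thesis
          using pairs_mono[OF H(1)] by (rule subset_trans)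
      qed
      then have edges: "set_mset (\<Sum>x\<in>S. f x) \<subseteq> pairs ?V" if "S \<subseteq> ?B" for S
        unfolding set_mset_sum[OF finite_subset[OF that finite_occurrences]]
        using that by blast
      have "(\<Sum>x\<in>?B. f x) = (\<Sum>x\<in>?A. f x) + (\<Sum>x\<in>?B - ?A. f x)"
        by (subst add.commute) (rule sum.subset_diff[OF AB finite_occurrences])
      then show ?thesis
        \<comment> \<open>\<open>edges\<close> serves twice: on \<open>?B - ?A\<close> for the added
          edges, on \<open>?A\<close> to see that the smaller graph is a multigraph.\<close>
        using monotone_increasing_union[OF \<P> _ in_P[unfolded G_def] edges[OF Diff_subset]]
          edges[OF AB]
        by (simp add: G_def is_multigraph_def)
    qed
    then show "AE f in M. f \<in> G ?A -` \<P> \<longrightarrow> f \<in> G ?B -` \<P>"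
      by (simp add: AE_measure_pmf_iff)
  qed simp
  ultimately show "measure_pmf.prob (random_multigraph n p \<H>1) \<P>
      \<le> measure_pmf.prob (random_multigraph n p \<H>2) \<P>"
    by simp
qed

end
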